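(* Suppose that there is a constant $k_f>0$ such that, for every $k$, almost surely $$\mathbb{E}\left[|F_k^g-f(X_k+\Delta_kG_k)|^2\,\middle|\,\mathcal{F}_{k-1}\right]\le k_f^2\Delta_k^4,\qquad \mathbb{E}\left[|F_k-f(X_k)|^2\,\middle|\,\mathcal{F}_{k-1}\right]\le k_f^2\Delta_k^4 .$$ Then, for every $k$ and every $\alpha>0$, almost surely $$\mathbb{P}\left(|F_k-F_k^g-(f(X_k)-f(X_k+\Delta_kG_k))|\ge \alpha\Delta_k^{q}\,\middle|\,\mathcal{F}_{k-1}\right)\le\frac{\varepsilon_q}{\alpha^{q/(q-1)}}$$ with $q=2$ and $\varepsilon_q=4k_f^2$.
   Context: $f:\mathbb{R}^n\to\mathbb{R}$ is locally Lipschitz continuous with $\inf f=f^*\in\mathbb{R}$. On a probability space, a stochastic derivative-free algorithm generates, for $k=0,1,2,\dots$, random iterates $X_k\in\mathbb{R}^n$, random stepsizes $\Delta_k>0$, random directions $G_k\in\mathbb{R}^n$, and real random variables $F_k$, $F_k^g$ which are estimates of $f(X_k)$ and $f(X_k+\Delta_kG_k)$ respectively. $\mathcal{F}_{k-1}$ is the $\sigma$-algebra generated by $(F_j,F_j^g)_{j=0}^{k-1}$ and $(G_j)_{j=0}^{k}$. $X_0$ and $\Delta_0$ are deterministic and $(X_{k+1},\Delta_{k+1})$ is determined by $(X_k,\Delta_k,G_k,F_k,F_k^g)$, so $X_k,\Delta_k,G_k$ are $\mathcal{F}_{k-1}$-measurable. *)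

theory Defs
  imports "HOL-Probability.Probability"
begin

(* The sigma-algebra F_{k-1} generated by (F_j, F^g_j) for j < k and by G_j for j <= k;
   the index is shifted by one so that F_{-1} = sigma(G_0) is the instance k = 0. *)
definition past_algebra ::
  "'w measure \<Rightarrow> (nat \<Rightarrow> 'w \<Rightarrow> real ^ 'n) \<Rightarrow> (nat \<Rightarrow> 'w \<Rightarrow> real) \<Rightarrow> (nat \<Rightarrow> 'w \<Rightarrow> real)
    \<Rightarrow> nat \<Rightarrow> 'w measure" where
  "past_algebra M G F Fg k = sigma (space M)
     ((\<Union>j<k. {F j -` B \<inter> space M |B. B \<in> sets borel}) \<union>
      (\<Union>j<k. {Fg j -` B \<inter> space M |B. B \<in> sets borel}) \<union>
      (\<Union>j\<le>k. {G j -` B \<inter> space M |B. B \<in> sets borel}))"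

definition cond_probability :: "'w measure \<Rightarrow> 'w measure \<Rightarrow> 'w set \<Rightarrow> 'w \<Rightarrow> real" where
  "cond_probability M N A = real_cond_exp M N (indicat_real A)"

(* The library's local_lipschitz speaks about time-dependent maps; f is read as a map that is
   constant in a dummy time parameter ranging over a singleton.
   The update rule may depend on k and is Borel measurable, which is what makes X k and Delta k
   measurable with respect to past_algebra M G F Fg k. *)
locale stochastic_dfo = prob_space M
  for M :: "'w measure" +
  fixes f :: "real ^ 'n \<Rightarrow> real"
    and fstar :: real
    and X :: "nat \<Rightarrow> 'w \<Rightarrow> real ^ 'n"
    and \<Delta> :: "nat \<Rightarrow> 'w \<Rightarrow> real"
    and G :: "nat \<Rightarrow> 'w \<Rightarrow> real ^ 'n"
    and F Fg :: "nat \<Rightarrow> 'w \<Rightarrow> real"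
  assumes f_lipschitz: "local_lipschitz {0::real} UNIV (\<lambda>_. f)"
    and f_bdd_below: "bdd_below (range f)"
    and f_inf: "(INF x. f x) = fstar"
    and G_measurable: "\<And>k. random_variable borel (G k)"
    and F_measurable: "\<And>k. random_variable borel (F k)"
    and Fg_measurable: "\<And>k. random_variable borel (Fg k)"
    and step_pos: "\<And>k \<omega>. \<omega> \<in> space M \<Longrightarrow> \<Delta> k \<omega> > 0"
    and init: "\<exists>x0 \<delta>0. \<forall>\<omega>\<in>space M. X 0 \<omega> = x0 \<and> \<Delta> 0 \<omega> = \<delta>0"
    and update: "\<And>k. \<exists>u. u \<in> measurable borel borel \<and>
      (\<forall>\<omega>\<in>space M. (X (Suc k) \<omega>, \<Delta> (Suc k) \<omega>) = u (X k \<omega>, \<Delta> k \<omega>, G k \<omega>, F k \<omega>, Fg k \<omega>))"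

end

theory Submission
  imports Defs
begin

text \<open>The estimate is the conditional Chebyshev inequality.  With
  \<open>a = F k - f (X k)\<close> and \<open>b = Fg k - f (X k + \<Delta> k G k)\<close>, the error in the event is \<open>a - b\<close>,
  so on the event \<open>\<alpha>\<^sup>2 \<Delta>\<^sup>4 \<le> (a - b)\<^sup>2 \<le> 2 (a\<^sup>2 + b\<^sup>2)\<close>.  Hence the indicator of the event is bounded
  by \<open>w (a\<^sup>2 + b\<^sup>2)\<close> with \<open>w = 2 / (\<alpha>\<^sup>2 \<Delta>\<^sup>4)\<close>.  The stepsize is determined by the past, so the weight
  \<open>w\<close> can be pulled out of the conditional expectation, and the two moment bounds give
  \<open>w * 2 k_f\<^sup>2 \<Delta>\<^sup>4 = 4 k_f\<^sup>2 / \<alpha>\<^sup>2\<close>: the random stepsize cancels.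

  The measurability of the stepsize with respect to the past (\<open>iterate_measurable_past\<close>) is what
  ties the argument to the structure of the algorithm; the probabilistic content is
  \<open>nn_cond_exp_indicator_le_weighted\<close>.  Conditional expectations of extended nonnegative functions
  are used throughout, because the squared errors are not known to be integrable: the moment bounds
  involve the stepsize, which may itself have no finite moments.\<close>

text \<open>Markov's inequality with a random threshold \<open>1 / w\<close> known to the conditioning
  \<open>\<sigma>\<close>-algebra.  Writing the threshold as a weight means that only products of extended
  nonnegative numbers occur, and no division.\<close>

lemma (in sigma_finite_subalgebra) nn_cond_exp_indicator_le_weighted:
  assumes A [measurable]: "A \<in> sets M"
    and w: "w \<in> borel_measurable F"
    and Y [measurable]: "Y \<in> borel_measurable M"
    and ge: "\<And>x. x \<in> A \<Longrightarrow> 1 \<le> w x * Y x"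
  shows "AE x in M. nn_cond_exp M F (indicator A) x \<le> w x * nn_cond_exp M F Y x"
proof -
  have [measurable]: "w \<in> borel_measurable M"
    by (rule measurable_from_subalg[OF subalg w])
  have "AE x in M. nn_cond_exp M F (indicator A) x \<le> nn_cond_exp M F (\<lambda>x. w x * Y x) x"
    by (rule nn_cond_exp_mono) (auto split: split_indicator simp: ge)
  with nn_cond_exp_prod[OF w Y] show ?thesis
    by eventually_elim simp
qed

text \<open>The real conditional expectation is a difference of the two extended nonnegative ones; an
  upper bound may drop the subtracted part, and finiteness comes from the bound itself.\<close>

lemma cond_probability_le_of_nn_cond_exp_le:
  assumes "nn_cond_exp M N (indicator A) \<omega> \<le> ennreal c" and "0 \<le> c"
  shows "cond_probability M N A \<omega> \<le> c"
proof -
  have "cond_probability M N A \<omega>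
      \<le> enn2real (nn_cond_exp M N (\<lambda>x. ennreal (indicat_real A x)) \<omega>)"
    by (simp add: cond_probability_def real_cond_exp_def)
  also have "\<dots> \<le> c"
    using assms by (intro enn2real_leI) (simp_all add: ennreal_indicator)
  finally show ?thesis .
qed

lemma space_past_algebra [simp]: "space (past_algebra M G F Fg k) = space M"
  unfolding past_algebra_def by (rule space_measure_of) auto

lemma sets_past_algebra:
  "sets (past_algebra M G F Fg k) = sigma_sets (space M)
     ((\<Union>j<k. {F j -` B \<inter> space M |B. B \<in> sets borel}) \<union>
      (\<Union>j<k. {Fg j -` B \<inter> space M |B. B \<in> sets borel}) \<union>
      (\<Union>j\<le>k. {G j -` B \<inter> space M |B. B \<in> sets borel}))"
  unfolding past_algebra_def by (rule sets_measure_of) auto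

lemma measurable_past_algebra_mono:
  assumes "j \<le> k" and h: "h \<in> measurable (past_algebra M G F Fg j) N"
  shows "h \<in> measurable (past_algebra M G F Fg k) N"
proof (rule measurable_from_subalg[OF _ h])
  show "subalgebra (past_algebra M G F Fg k) (past_algebra M G F Fg j)"
    unfolding subalgebra_def sets_past_algebra space_past_algebra using \<open>j \<le> k\<close>
    by (intro conjI refl sigma_sets_mono' Un_mono UN_mono order_refl) auto
qed

lemma direction_measurable_past:
  "j \<le> k \<Longrightarrow> G j \<in> borel_measurable (past_algebra M G F Fg k)"
  by (rule measurableI) (auto simp: sets_past_algebra intro!: sigma_sets.Basic)

lemma estimates_measurable_past:
  assumes "j < k"
  shows "F j \<in> borel_measurable (past_algebra M G F Fg k)" (is ?F)
    and "Fg j \<in> borel_measurable (past_algebra M G F Fg k)" (is ?Fg)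
proof -
  show ?F
    by (rule measurableI)
      (use assms in \<open>auto simp: sets_past_algebra intro!: sigma_sets.Basic UnI1\<close>)
  show ?Fg
    by (rule measurableI)
      (use assms in \<open>auto simp: sets_past_algebra intro!: sigma_sets.Basic UnI1[OF UnI2]\<close>)
qed

context stochastic_dfo
begin

lemma sigma_finite_subalgebra_past: "sigma_finite_subalgebra M (past_algebra M G F Fg k)"
proof (rule finite_measure_subalgebra_is_sigma_finite)
  have "subalgebra M (past_algebra M G F Fg k)"
    unfolding subalgebra_def sets_past_algebra space_past_algebra
    using G_measurable F_measurable Fg_measurable
    by (auto intro!: sets.sigma_sets_subset measurable_sets)
  then show "finite_measure_subalgebra M (past_algebra M G F Fg k)"
    by unfold_locales
qed

text \<open>The iterate and the stepsize are treated as a pair because the update rule is only jointly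
  measurable: neither component satisfies a recursion of its own.\<close>

lemma iterate_measurable_past:
  "(\<lambda>\<omega>. (X k \<omega>, \<Delta> k \<omega>)) \<in> borel_measurable (past_algebra M G F Fg k)"
proof (induction k)
  case 0
  obtain x0 \<delta>0 where "\<forall>\<omega>\<in>space M. X 0 \<omega> = x0 \<and> \<Delta> 0 \<omega> = \<delta>0"
    using init by blast
  then have "(\<lambda>\<omega>. (X 0 \<omega>, \<Delta> 0 \<omega>)) \<in> borel_measurable (past_algebra M G F Fg 0)
      \<longleftrightarrow> (\<lambda>_. (x0, \<delta>0)) \<in> borel_measurable (past_algebra M G F Fg 0)"
    by (intro measurable_cong) simp
  then show ?case by simp
next
  case (Suc k)
  let ?N = "past_algebra M G F Fg (Suc k)"
  obtain u where u: "u \<in> borel_measurable borel"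
    and upd: "\<forall>\<omega>\<in>space M. (X (Suc k) \<omega>, \<Delta> (Suc k) \<omega>) = u (X k \<omega>, \<Delta> k \<omega>, G k \<omega>, F k \<omega>, Fg k \<omega>)"
    using update by blast
  have XD: "(\<lambda>\<omega>. (X k \<omega>, \<Delta> k \<omega>)) \<in> borel_measurable ?N"
    by (rule measurable_past_algebra_mono[OF _ Suc]) simp
  have X: "X k \<in> borel_measurable ?N"
    using borel_measurable_continuous_on[OF continuous_on_fst[OF continuous_on_id] XD] by simp
  have D: "\<Delta> k \<in> borel_measurable ?N"
    using borel_measurable_continuous_on[OF continuous_on_snd[OF continuous_on_id] XD] by simp
  have "(\<lambda>\<omega>. (X k \<omega>, \<Delta> k \<omega>, G k \<omega>, F k \<omega>, Fg k \<omega>)) \<in> borel_measurable ?N"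
    by (intro borel_measurable_Pair X D direction_measurable_past estimates_measurable_past) simp_all
  from measurable_compose[OF this u]
  have "(\<lambda>\<omega>. u (X k \<omega>, \<Delta> k \<omega>, G k \<omega>, F k \<omega>, Fg k \<omega>)) \<in> borel_measurable ?N" .
  also have "?this \<longleftrightarrow> ?case"
    using upd by (intro measurable_cong) simp
  finally show ?case .
qed

lemma point_measurable_past: "X k \<in> borel_measurable (past_algebra M G F Fg k)"
  using borel_measurable_continuous_on[OF continuous_on_fst[OF continuous_on_id] iterate_measurable_past]
  by simp

lemma stepsize_measurable_past: "\<Delta> k \<in> borel_measurable (past_algebra M G F Fg k)"
  using borel_measurable_continuous_on[OF continuous_on_snd[OF continuous_on_id] iterate_measurable_past]
  by simp

lemma objective_borel_measurable: "f \<in> borel_measurable borel"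
  using local_lipschitz_continuous_on[OF f_lipschitz, of 0]
  by (intro borel_measurable_continuous_onI) simp

text \<open>The two estimates may be correlated given the past, so the cross term of \<open>(a - b)\<^sup>2\<close> is
  absorbed by \<open>(a - b)\<^sup>2 \<le> 2 (a\<^sup>2 + b\<^sup>2)\<close>; this costs a factor \<open>2\<close> and, with the two moment
  bounds, gives the constant \<open>4\<close>.\<close>

lemma cond_probability_difference_error_le:
  assumes "\<alpha> > 0"
    and Fg_moment: "AE \<omega> in M. nn_cond_exp M (past_algebra M G F Fg k)
        (\<lambda>\<omega>. ennreal (\<bar>Fg k \<omega> - f (X k \<omega> + \<Delta> k \<omega> *\<^sub>R G k \<omega>)\<bar>\<^sup>2)) \<omega>
      \<le> ennreal (c\<^sup>2 * \<Delta> k \<omega> ^ 4)"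
    and F_moment: "AE \<omega> in M. nn_cond_exp M (past_algebra M G F Fg k)
        (\<lambda>\<omega>. ennreal (\<bar>F k \<omega> - f (X k \<omega>)\<bar>\<^sup>2)) \<omega>
      \<le> ennreal (c\<^sup>2 * \<Delta> k \<omega> ^ 4)"
  shows "AE \<omega> in M. cond_probability M (past_algebra M G F Fg k)
      {\<omega> \<in> space M. \<bar>F k \<omega> - Fg k \<omega> - (f (X k \<omega>) - f (X k \<omega> + \<Delta> k \<omega> *\<^sub>R G k \<omega>))\<bar>
                       \<ge> \<alpha> * (\<Delta> k \<omega>)\<^sup>2} \<omega>
    \<le> 4 * c\<^sup>2 / \<alpha>\<^sup>2"
proof -
  let ?N = "past_algebra M G F Fg k"
  interpret N: sigma_finite_subalgebra M ?N
    by (rule sigma_finite_subalgebra_past)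
  note [measurable] = F_measurable Fg_measurable G_measurable objective_borel_measurable
    measurable_from_subalg[OF N.subalg point_measurable_past]
    measurable_from_subalg[OF N.subalg stepsize_measurable_past]
  define a where "a \<omega> = F k \<omega> - f (X k \<omega>)" for \<omega>
  define b where "b \<omega> = Fg k \<omega> - f (X k \<omega> + \<Delta> k \<omega> *\<^sub>R G k \<omega>)" for \<omega>
  define A where "A = {\<omega> \<in> space M. \<alpha> * (\<Delta> k \<omega>)\<^sup>2 \<le> \<bar>a \<omega> - b \<omega>\<bar>}"
  define w where "w = (\<lambda>\<omega>. 2 / (\<alpha>\<^sup>2 * \<Delta> k \<omega> ^ 4))"
  have [measurable]: "a \<in> borel_measurable M" "b \<in> borel_measurable M"
    unfolding a_def[abs_def] b_def[abs_def] by measurable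
  have A: "A \<in> sets M"
    unfolding A_def by measurable
  have w: "(\<lambda>\<omega>. ennreal (w \<omega>)) \<in> borel_measurable ?N"
    using stepsize_measurable_past unfolding w_def by measurable
  have ge: "1 \<le> ennreal (w \<omega>) * (ennreal (\<bar>b \<omega>\<bar>\<^sup>2) + ennreal (\<bar>a \<omega>\<bar>\<^sup>2))" if "\<omega> \<in> A" for \<omega>
  proof -
    have pos: "0 < \<alpha>\<^sup>2 * \<Delta> k \<omega> ^ 4"
      using that \<open>\<alpha> > 0\<close> step_pos[of \<omega> k] by (simp add: A_def)
    have "\<alpha>\<^sup>2 * \<Delta> k \<omega> ^ 4 = (\<alpha> * (\<Delta> k \<omega>)\<^sup>2)\<^sup>2"
      by (simp add: power_mult_distrib flip: power_mult)
    also have "\<dots> \<le> \<bar>a \<omega> - b \<omega>\<bar>\<^sup>2"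
      using that \<open>\<alpha> > 0\<close> by (intro power_mono) (auto simp: A_def)
    also have "\<dots> \<le> 2 * ((b \<omega>)\<^sup>2 + (a \<omega>)\<^sup>2)"
      using zero_le_power2[of "a \<omega> + b \<omega>"] by (simp add: power2_eq_square algebra_simps)
    finally have "1 \<le> w \<omega> * ((b \<omega>)\<^sup>2 + (a \<omega>)\<^sup>2)"
      using pos by (simp add: w_def field_simps)
    then have "ennreal 1 \<le> ennreal (w \<omega> * ((b \<omega>)\<^sup>2 + (a \<omega>)\<^sup>2))"
      by (rule ennreal_leI)
    also have "\<dots> = ennreal (w \<omega>) * (ennreal (\<bar>b \<omega>\<bar>\<^sup>2) + ennreal (\<bar>a \<omega>\<bar>\<^sup>2))"
    proof -
      have "0 \<le> w \<omega>"
        using pos by (simp add: w_def)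
      then show ?thesis
        by (simp add: ennreal_mult)
    qed
    finally show ?thesis
      by simp
  qed
  have "AE \<omega> in M. nn_cond_exp M ?N (indicator A) \<omega>
      \<le> ennreal (w \<omega>) * nn_cond_exp M ?N (\<lambda>\<omega>. ennreal (\<bar>b \<omega>\<bar>\<^sup>2) + ennreal (\<bar>a \<omega>\<bar>\<^sup>2)) \<omega>"
    by (rule N.nn_cond_exp_indicator_le_weighted[OF A w _ ge]) measurable
  moreover have "AE \<omega> in M.
      nn_cond_exp M ?N (\<lambda>\<omega>. ennreal (\<bar>b \<omega>\<bar>\<^sup>2)) \<omega> + nn_cond_exp M ?N (\<lambda>\<omega>. ennreal (\<bar>a \<omega>\<bar>\<^sup>2)) \<omega>
      = nn_cond_exp M ?N (\<lambda>\<omega>. ennreal (\<bar>b \<omega>\<bar>\<^sup>2) + ennreal (\<bar>a \<omega>\<bar>\<^sup>2)) \<omega>"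
    by (rule N.nn_cond_exp_sum) measurable
  ultimately have "AE \<omega> in M. cond_probability M ?N A \<omega> \<le> 4 * c\<^sup>2 / \<alpha>\<^sup>2"
    using Fg_moment[folded b_def] F_moment[folded a_def] AE_space
  proof eventually_elim
    case (elim \<omega>)
    have D: "\<Delta> k \<omega> > 0"
      using elim step_pos by simp
    have "nn_cond_exp M ?N (indicator A) \<omega>
        \<le> ennreal (w \<omega>) * (ennreal (c\<^sup>2 * \<Delta> k \<omega> ^ 4) + ennreal (c\<^sup>2 * \<Delta> k \<omega> ^ 4))"
      by (rule order_trans[OF elim(1)[folded elim(2)] mult_left_mono[OF add_mono[OF elim(3,4)]]])
        simp
    also have "\<dots> = ennreal (w \<omega> * (c\<^sup>2 * \<Delta> k \<omega> ^ 4 + c\<^sup>2 * \<Delta> k \<omega> ^ 4))"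
    proof -
      have "0 \<le> w \<omega>" "0 \<le> c\<^sup>2 * \<Delta> k \<omega> ^ 4"
        using D by (simp_all add: w_def)
      then show ?thesis
        by (simp only: ennreal_mult ennreal_plus add_nonneg_nonneg)
    qed
    also have "w \<omega> * (c\<^sup>2 * \<Delta> k \<omega> ^ 4 + c\<^sup>2 * \<Delta> k \<omega> ^ 4) = 4 * c\<^sup>2 / \<alpha>\<^sup>2"
      using D \<open>\<alpha> > 0\<close> by (simp add: w_def field_simps)
    finally show ?case
      by (rule cond_probability_le_of_nn_cond_exp_le) simp
  qed
  moreover have "A = {\<omega> \<in> space M.
      \<bar>F k \<omega> - Fg k \<omega> - (f (X k \<omega>) - f (X k \<omega> + \<Delta> k \<omega> *\<^sub>R G k \<omega>))\<bar> \<ge> \<alpha> * (\<Delta> k \<omega>)\<^sup>2}"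
    by (simp add: A_def a_def b_def algebra_simps)
  ultimately show ?thesis
    by simp
qed

end

theorem proposition2p10:
  fixes M :: "'w measure"
    and f :: "real ^ 'n \<Rightarrow> real"
    and fstar k_f q \<epsilon>\<^sub>q :: real
    and X G :: "nat \<Rightarrow> 'w \<Rightarrow> real ^ 'n"
    and \<Delta> F Fg :: "nat \<Rightarrow> 'w \<Rightarrow> real"
  assumes "stochastic_dfo M f fstar X \<Delta> G F Fg"
    and "k_f > 0"
    and "\<forall>k. AE \<omega> in M.
      nn_cond_exp M (past_algebra M G F Fg k)
        (\<lambda>\<omega>. ennreal (\<bar>Fg k \<omega> - f (X k \<omega> + \<Delta> k \<omega> *\<^sub>R G k \<omega>)\<bar>\<^sup>2)) \<omega>
      \<le> ennreal (k_f\<^sup>2 * \<Delta> k \<omega> ^ 4)"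
    and "\<forall>k. AE \<omega> in M.
      nn_cond_exp M (past_algebra M G F Fg k)
        (\<lambda>\<omega>. ennreal (\<bar>F k \<omega> - f (X k \<omega>)\<bar>\<^sup>2)) \<omega>
      \<le> ennreal (k_f\<^sup>2 * \<Delta> k \<omega> ^ 4)"
    and "q = 2"
    and "\<epsilon>\<^sub>q = 4 * k_f\<^sup>2"
  shows "\<forall>k. \<forall>\<alpha>>0. AE \<omega> in M.
      cond_probability M (past_algebra M G F Fg k)
        {\<omega> \<in> space M. \<bar>F k \<omega> - Fg k \<omega> - (f (X k \<omega>) - f (X k \<omega> + \<Delta> k \<omega> *\<^sub>R G k \<omega>))\<bar>
                         \<ge> \<alpha> * \<Delta> k \<omega> powr q} \<omega>
      \<le> \<epsilon>\<^sub>q / \<alpha> powr (q / (q - 1))"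
proof (intro allI impI)
  fix k :: nat and \<alpha> :: real
  assume "\<alpha> > 0"
  interpret stochastic_dfo M f fstar X \<Delta> G F Fg
    by fact
  let ?err = "\<lambda>\<omega>. \<bar>F k \<omega> - Fg k \<omega> - (f (X k \<omega>) - f (X k \<omega> + \<Delta> k \<omega> *\<^sub>R G k \<omega>))\<bar>"
  have "{\<omega> \<in> space M. ?err \<omega> \<ge> \<alpha> * \<Delta> k \<omega> powr q} = {\<omega> \<in> space M. ?err \<omega> \<ge> \<alpha> * (\<Delta> k \<omega>)\<^sup>2}"
    using step_pos \<open>q = 2\<close> by (auto simp: less_imp_le)
  moreover have "\<alpha> powr (q / (q - 1)) = \<alpha>\<^sup>2"
    using \<open>\<alpha> > 0\<close> \<open>q = 2\<close> by simp
  ultimately show "AE \<omega> in M. cond_probability M (past_algebra M G F Fg k)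
      {\<omega> \<in> space M. ?err \<omega> \<ge> \<alpha> * \<Delta> k \<omega> powr q} \<omega> \<le> \<epsilon>\<^sub>q / \<alpha> powr (q / (q - 1))"
    using cond_probability_difference_error_le[OF \<open>\<alpha> > 0\<close> assms(3)[rule_format] assms(4)[rule_format]]
      \<open>\<epsilon>\<^sub>q = 4 * k_f\<^sup>2\<close>
    by simp
qed

end
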